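(* There is an absolute constant $C>0$ such that the following holds. Let $T$ be a triangle and let $q$ be a quadratic function whose associated quadratic form $\mathbf q$ is positive definite. Let $$k=\frac{\ln\sigma_{\mathbf q}(T)-\ln 5}{-\ln(0.69)} .$$ Then for every integer $n\ge1$, after $n$ applications of the refinement procedure (for $q$) starting from $T$, at most $C\,n^k\,7^{n/3}$ of the $2^n$ generated triangles $S$ satisfy $\sigma_{\mathbf q}(S)\ge5$. Therefore the proportion of such triangles among the $2^n$ generated ones tends exponentially fast to $0$ as $n\to+\infty$.
   Context: Triangles are nondegenerate; $|T|$ is the area of $T$. For a quadratic polynomial $q(x,y)=a_{2,0}x^2+2a_{1,1}xy+a_{0,2}y^2+a_{1,0}x+a_{0,1}y+a_{0,0}$, its associated quadratic form is $\mathbf q(x,y)=a_{2,0}x^2+2a_{1,1}xy+a_{0,2}y^2$, and $\det\mathbf q:=a_{2,0}a_{0,2}-a_{1,1}^2$. For $\mathbf q$ positive definite, $|v|_{\mathbf q}:=\sqrt{\mathbf q(v)}$. Edges of a triangle are regarded as vectors $a,b,c$ with $a+b+c=0$. If $|a|_{\mathbf q}\ge|b|_{\mathbf q}\ge|c|_{\mathbf q}$, define $$\sigma_{\mathbf q}(T):=\frac{\mathbf q(b)+\mathbf q(c)}{4|T|\sqrt{\det\mathbf q}} .$$ Refinement procedure for a function $f$ (here $f=q$): a triangle $T$ is bisected from the mid-point of an edge $e$ to the opposite vertex, giving children $T_e^1,T_e^2$, where $e$ minimizes over the three edges of $T$ the decision function $d_T(e,f):=\|f-I_{T_e^1}f\|_{L^1(T_e^1)}+\|f-I_{T_e^2}f\|_{L^1(T_e^2)}$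 (ties broken arbitrarily), and $I_S f$ is the affine interpolant of $f$ at the vertices of $S$. Applying the procedure $n$ times starting from $T$ means: bisect $T$, then bisect all resulting triangles, and so on for $n$ generations, giving $2^n$ triangles. *)

theory Defs
  imports "HOL-Analysis.Analysis"
begin

type_synonym point = "real ^ 2"

text \<open>A triangle is given by its three vertices; nondegeneracy is a separate predicate.\<close>

type_synonym triangle = "point \<times> point \<times> point"

fun nondegenerate :: "triangle \<Rightarrow> bool" where
  "nondegenerate (A, B, C) \<longleftrightarrow> \<not> collinear {A, B, C}"

fun region :: "triangle \<Rightarrow> point set" where
  "region (A, B, C) = convex hull {A, B, C}"

definition area :: "triangle \<Rightarrow> real" where
  "area T = measure lborel (region T)"

fun edge_vectors :: "triangle \<Rightarrow> point list" where
  "edge_vectors (A, B, C) = [B - A, C - B, A - C]"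


text \<open>The selector names give the exponents of the monomials; note the factor \<open>2\<close> carried
  by the mixed coefficient \<open>a11\<close> in \<open>poly_fun\<close> and \<open>quad_form\<close>.\<close>

datatype quad_poly =
  Quad_Poly (a20: real) (a11: real) (a02: real) (a10: real) (a01: real) (a00: real)

definition poly_fun :: "quad_poly \<Rightarrow> point \<Rightarrow> real" where
  "poly_fun q v = a20 q * (v $ 1)\<^sup>2 + 2 * a11 q * (v $ 1) * (v $ 2) + a02 q * (v $ 2)\<^sup>2
     + a10 q * (v $ 1) + a01 q * (v $ 2) + a00 q"

definition quad_form :: "quad_poly \<Rightarrow> point \<Rightarrow> real" where
  "quad_form q v = a20 q * (v $ 1)\<^sup>2 + 2 * a11 q * (v $ 1) * (v $ 2) + a02 q * (v $ 2)\<^sup>2"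

definition quad_det :: "quad_poly \<Rightarrow> real" where
  "quad_det q = a20 q * a02 q - (a11 q)\<^sup>2"

definition pos_definite :: "quad_poly \<Rightarrow> bool" where
  "pos_definite q \<longleftrightarrow> (\<forall>v. v \<noteq> 0 \<longrightarrow> quad_form q v > 0)"

definition quad_norm :: "quad_poly \<Rightarrow> point \<Rightarrow> real" where
  "quad_norm q v = sqrt (quad_form q v)"

text \<open>Sorting the edge vectors by increasing \<open>quad_norm\<close> puts the two shortest ones at
  positions \<open>0\<close> and \<open>1\<close>.  By \<open>shape_measure_eq\<close> below the value does not depend on how
  ties are resolved.\<close>

definition shape_measure :: "quad_poly \<Rightarrow> triangle \<Rightarrow> real" where
  "shape_measure q T =
     (let es = sort_key (quad_norm q) (edge_vectors T); c = es ! 0; b = es ! 1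
      in (quad_form q b + quad_form q c) / (4 * area T * sqrt (quad_det q)))"

lemma shape_measure_eq:
  assumes "mset [a, b, c] = mset (edge_vectors T)"
    and "quad_norm q a \<ge> quad_norm q b" "quad_norm q b \<ge> quad_norm q c"
  shows "shape_measure q T =
    (quad_form q b + quad_form q c) / (4 * area T * sqrt (quad_det q))"
proof -
  define es where "es = sort_key (quad_norm q) (edge_vectors T)"
  have "mset es = mset (edge_vectors T)" by (simp add: es_def)
  also have "\<dots> = mset [c, b, a]"
    unfolding assms(1)[symmetric] by (simp add: add_mset_commute)
  finally have "mset (map (quad_norm q) es) = mset (map (quad_norm q) [c, b, a])"
    unfolding mset_map by (rule arg_cong)
  moreover have "sorted (map (quad_norm q) es)"
    by (simp add: es_def)
  moreover have "sorted (map (quad_norm q) [c, b, a])"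
    using assms(2,3) by simp
  ultimately have m: "map (quad_norm q) es = map (quad_norm q) [c, b, a]"
    using properties_for_sort[of "map (quad_norm q) es" "map (quad_norm q) [c, b, a]"]
      properties_for_sort[of "map (quad_norm q) es" "map (quad_norm q) es"] by simp
  then have len: "length es = 3"
    using length_map[of "quad_norm q" es] by simp
  have "quad_norm q (es ! 0) = quad_norm q c"
    using arg_cong[OF m, of "\<lambda>l. l ! 0"] len by simp
  moreover have "quad_norm q (es ! 1) = quad_norm q b"
    using arg_cong[OF m, of "\<lambda>l. l ! 1"] len by simp
  ultimately have "quad_form q (es ! 0) = quad_form q c" "quad_form q (es ! 1) = quad_form q b"
    by (simp_all add: quad_norm_def)
  then show ?thesis
    by (simp only: shape_measure_def es_def Let_def)
qed


definition affine_fun :: "(point \<Rightarrow> real) \<Rightarrow> bool" where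
  "affine_fun g \<longleftrightarrow> (\<exists>w d. \<forall>x. g x = w \<bullet> x + d)"

fun interpolates :: "(point \<Rightarrow> real) \<Rightarrow> (point \<Rightarrow> real) \<Rightarrow> triangle \<Rightarrow> bool" where
  "interpolates g f (A, B, C) \<longleftrightarrow> g A = f A \<and> g B = f B \<and> g C = f C"

definition affine_interpolant :: "(point \<Rightarrow> real) \<Rightarrow> triangle \<Rightarrow> point \<Rightarrow> real" where
  "affine_interpolant f S = (THE g. affine_fun g \<and> interpolates g f S)"

definition L1_error :: "(point \<Rightarrow> real) \<Rightarrow> triangle \<Rightarrow> real" where
  "L1_error f S = (LINT x:region S|lborel. \<bar>f x - affine_interpolant f S x\<bar>)"


text \<open>An edge of a triangle is encoded as the rotation of the vertex triple in which the
  endpoints of that edge come first and the opposite vertex comes last.\<close>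

fun edge_choices :: "triangle \<Rightarrow> triangle set" where
  "edge_choices (A, B, C) = {(A, B, C), (B, C, A), (C, A, B)}"

fun child1 :: "triangle \<Rightarrow> triangle" where
  "child1 (A, B, C) = (A, midpoint A B, C)"

fun child2 :: "triangle \<Rightarrow> triangle" where
  "child2 (A, B, C) = (midpoint A B, B, C)"

definition decision :: "(point \<Rightarrow> real) \<Rightarrow> triangle \<Rightarrow> real" where
  "decision f e = L1_error f (child1 e) + L1_error f (child2 e)"

definition greedy_bisection :: "(point \<Rightarrow> real) \<Rightarrow> triangle \<Rightarrow> triangle \<Rightarrow> triangle \<Rightarrow> bool" where
  "greedy_bisection f T S1 S2 \<longleftrightarrow>
     (\<exists>e \<in> edge_choices T. (\<forall>e' \<in> edge_choices T. decision f e \<le> decision f e')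
        \<and> S1 = child1 e \<and> S2 = child2 e)"

text \<open>A run of the procedure is the infinite binary tree of all triangles it generates: the
  node at address \<open>s\<close> has children at \<open>False # s\<close> and \<open>True # s\<close>, and the \<open>2 ^ n\<close> addresses of
  length \<open>n\<close> index generation \<open>n\<close>.  Ties are resolved arbitrarily and independently at each
  node, so a run is a relation and not a function of \<open>f\<close> and \<open>T\<close>.\<close>

definition refinement_run :: "(point \<Rightarrow> real) \<Rightarrow> triangle \<Rightarrow> (bool list \<Rightarrow> triangle) \<Rightarrow> bool" where
  "refinement_run f T R \<longleftrightarrow>
     R [] = T \<and> (\<forall>s. greedy_bisection f (R s) (R (False # s)) (R (True # s)))"

definition generation :: "nat \<Rightarrow> bool list set" where
  "generation n = {s. length s = n}"

lemma card_generation: "finite (generation n)" "card (generation n) = 2 ^ n"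
  using finite_lists_length_eq[of "UNIV :: bool set" n] card_lists_length_eq[of "UNIV :: bool set" n]
  by (simp_all add: generation_def)

definition num_bad :: "quad_poly \<Rightarrow> (bool list \<Rightarrow> triangle) \<Rightarrow> nat \<Rightarrow> nat" where
  "num_bad q R n = card {s \<in> generation n. shape_measure q (R s) \<ge> 5}"


lemma ex1_affine_interpolant:
  assumes "nondegenerate S"
  shows "\<exists>!g. affine_fun g \<and> interpolates g f S"
proof -
  obtain A B C where S: "S = (A, B, C)" by (cases S)
  define u v where "u = B - A" and "v = C - A"
  define D where "D = u $ 1 * v $ 2 - u $ 2 * v $ 1"
  have D: "D \<noteq> 0"
  proof
    assume D0: "D = 0"
    have "collinear {0, u, v}"
    proof (cases "u = 0")
      case False
      then consider "u $ 1 \<noteq> 0" | "u $ 2 \<noteq> 0" by (auto simp: vec_eq_iff forall_2)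
      then have "\<exists>c. v = c *\<^sub>R u"
      proof cases
        case 1
        then show ?thesis
          using D0 by (intro exI[of _ "v $ 1 / u $ 1"])
            (auto simp: D_def vec_eq_iff forall_2 field_simps)
      next
        case 2
        then show ?thesis
          using D0 by (intro exI[of _ "v $ 2 / u $ 2"])
            (auto simp: D_def vec_eq_iff forall_2 field_simps)
      qed
      then show ?thesis by (auto simp: collinear_lemma)
    qed (auto simp: collinear_lemma)
    moreover have "collinear {B, A, C} \<longleftrightarrow> collinear {0, B - A, C - A}"
      using collinear_3[of B A C] by simp
    ultimately have "collinear {A, B, C}" by (simp add: u_def v_def insert_commute)
    then show False using assms S by simp
  qed
  define w :: point where
    "w = vector [((f B - f A) * v $ 2 - (f C - f A) * u $ 2) / D,
                 ((f C - f A) * u $ 1 - (f B - f A) * v $ 1) / D]"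
  have wu: "w \<bullet> u = f B - f A"
    using D by (simp add: w_def inner_vec_def sum_2 divide_simps) (simp add: D_def algebra_simps)
  have wv: "w \<bullet> v = f C - f A"
    using D by (simp add: w_def inner_vec_def sum_2 divide_simps) (simp add: D_def algebra_simps)
  have uniq: "w' = 0" if "w' \<bullet> u = 0" "w' \<bullet> v = 0" for w' :: point
  proof -
    have e: "w' $ 1 * u $ 1 + w' $ 2 * u $ 2 = 0" "w' $ 1 * v $ 1 + w' $ 2 * v $ 2 = 0"
      using that by (simp_all add: inner_vec_def sum_2)
    have "w' $ 1 * D = (w' $ 1 * u $ 1 + w' $ 2 * u $ 2) * v $ 2 - (w' $ 1 * v $ 1 + w' $ 2 * v $ 2) * u $ 2"
      by (simp add: D_def algebra_simps)
    moreover have "w' $ 2 * D = (w' $ 1 * v $ 1 + w' $ 2 * v $ 2) * u $ 1 - (w' $ 1 * u $ 1 + w' $ 2 * u $ 2) * v $ 1"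
      by (simp add: D_def algebra_simps)
    ultimately have "w' $ 1 * D = 0" "w' $ 2 * D = 0" unfolding e by simp_all
    then show ?thesis using D by (simp add: vec_eq_iff forall_2)
  qed
  show ?thesis
  proof (rule ex1I[of _ "\<lambda>x. w \<bullet> x + (f A - w \<bullet> A)"])
    show "affine_fun (\<lambda>x. w \<bullet> x + (f A - w \<bullet> A)) \<and>
        interpolates (\<lambda>x. w \<bullet> x + (f A - w \<bullet> A)) f S"
      using wu wv by (auto simp: S affine_fun_def u_def v_def inner_diff_right)
  next
    fix g assume g: "affine_fun g \<and> interpolates g f S"
    then obtain w1 d where g1: "\<And>x. g x = w1 \<bullet> x + d" by (auto simp: affine_fun_def)
    then have i: "w1 \<bullet> A + d = f A" "w1 \<bullet> B + d = f B" "w1 \<bullet> C + d = f C"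
      using g by (auto simp: S)
    then have "w1 - w = 0"
      using wu wv by (intro uniq) (auto simp: u_def v_def inner_diff_right inner_diff_left)
    then show "g = (\<lambda>x. w \<bullet> x + (f A - w \<bullet> A))"
      using i(1) by (auto simp: g1 fun_eq_iff)
  qed
qed

lemma greedy_bisection_exists: "\<exists>S1 S2. greedy_bisection f T S1 S2"
proof -
  let ?e = "arg_min_on (decision f) (edge_choices T)"
  have E: "finite (edge_choices T)" "edge_choices T \<noteq> {}" by (cases T; simp)+
  then have "?e \<in> edge_choices T" by (rule arg_min_if_finite(1))
  moreover have "\<forall>e' \<in> edge_choices T. decision f ?e \<le> decision f e'"
    using arg_min_least[OF E] by blast
  ultimately show ?thesis unfolding greedy_bisection_def by blast
qed

lemma refinement_run_exists: "\<exists>R. refinement_run f T R"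
proof -
  obtain c1 c2 where c: "\<And>S. greedy_bisection f S (c1 S) (c2 S)"
    using greedy_bisection_exists by metis
  define R where "R = rec_list T (\<lambda>b s S. if b then c2 S else c1 S)"
  have "refinement_run f T R" by (simp add: refinement_run_def R_def c)
  then show ?thesis by blast
qed

end

theory Submission
  imports Defs
begin

text \<open>Throughout, \<open>q\<close> denotes the quadratic form as well, and lengths and areas are measured in the
  Euclidean structure that it defines.

  For a positive definite quadratic function the interpolation error on a triangle has constant
  sign, and integrating it (\<open>L1_error_eq\<close>) gives a constant times the area times the sum of the
  squared edge lengths.  Hence the decision function is, up to a factor depending on the triangle
  only, the sum of the squared lengths of the two edges that are not bisected, and the procedure
  always bisects a longest edge (\<open>greedy_bisection_longest\<close>).  From then on only squared lengths
  matter: if \<open>a\<close> is the largest of \<open>a\<close>, \<open>b\<close>, \<open>c\<close>, the children have squared edge lengths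
  \<open>a/4, m, c\<close> and \<open>a/4, m, b\<close>, where \<open>m = (2b + 2c - a)/4\<close> belongs to the median.

  Since \<open>a/4 + m = (b + c)/2\<close>, the shape measure never increases along the refinement
  (\<open>shape_measure_antimono\<close>).  Moreover, if it is at least \<open>5\<close>, the triangle is so flat that after
  two generations at least one of its four grandchildren has at most \<open>0.69\<close> times its shape
  measure (\<open>grandchild_shape_reduction\<close>).  This rests on an inequality between quadratic forms on a
  polyhedral cone (\<open>thin_triangle_inequality\<close>).

  To count, give every triangle of shape measure \<open>\<sigma> \<ge> 5\<close> the weight \<open>(\<sigma>/5) powr p\<close> and all others
  the weight \<open>0\<close>.  Two generations multiply the total weight by at most \<open>3 + 0.69 powr p\<close>, and the
  total weight bounds the number of bad triangles (\<open>num_bad_le\<close>).  Different choices of \<open>p \<ge> 0\<close>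
  yield the two assertions: \<open>0.69 powr p = 1/n\<close> gives the bound for the \<open>n\<close>-th generation, even
  with \<open>3 powr (n/2)\<close> in place of \<open>7 powr (n/3)\<close>, and \<open>p = 1\<close> gives the exponential decay of the
  proportion.\<close>

section \<open>Triangles as affine images of the standard triangle\<close>

definition cross2 :: "point \<Rightarrow> point \<Rightarrow> real" where
  "cross2 u v = u $ 1 * v $ 2 - u $ 2 * v $ 1"

text \<open>The point of the plane with barycentric coordinates \<open>1 - x$1 - x$2\<close>, \<open>x$1\<close>, \<open>x$2\<close> with
  respect to \<open>A\<close>, \<open>B\<close>, \<open>C\<close>.  As a function of \<open>x\<close> it maps the standard triangle onto the given
  one, so all integrals can be computed over one fixed domain.\<close>

definition barycentric_point :: "triangle \<Rightarrow> point \<Rightarrow> point" where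
  "barycentric_point = (\<lambda>(A, B, C) x. A + (x $ 1) *\<^sub>R (B - A) + (x $ 2) *\<^sub>R (C - A))"

definition std_triangle :: "point set" where
  "std_triangle = {x. 0 \<le> x $ 1 \<and> 0 \<le> x $ 2 \<and> x $ 1 + x $ 2 \<le> 1}"

lemma region_eq_image: "region T = barycentric_point T ` std_triangle"
proof -
  obtain A B C where T: "T = (A, B, C)" by (cases T)
  show ?thesis
  proof
    show "region T \<subseteq> barycentric_point T ` std_triangle"
    proof
      fix y assume "y \<in> region T"
      then obtain u v where "y = A + u *\<^sub>R (B - A) + v *\<^sub>R (C - A)" "0 \<le> u" "0 \<le> v" "u + v \<le> 1"
        by (auto simp: T convex_hull_3_alt)
      then have "y = barycentric_point T (vector [u, v])" "vector [u, v] \<in> std_triangle"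
        by (auto simp: T barycentric_point_def std_triangle_def)
      then show "y \<in> barycentric_point T ` std_triangle" by blast
    qed
    show "barycentric_point T ` std_triangle \<subseteq> region T"
      by (auto simp: T convex_hull_3_alt barycentric_point_def std_triangle_def)
  qed
qed

lemma barycentric_point_id: "barycentric_point (0, axis 1 1, axis 2 1) = id"
  by (auto simp: barycentric_point_def fun_eq_iff vec_eq_iff forall_2 axis_def)

lemma std_triangle_eq: "std_triangle = convex hull {0, axis 1 1, axis 2 1}"
  using region_eq_image[of "(0, axis 1 1, axis 2 1)"] by (simp add: barycentric_point_id)

lemma compact_std_triangle: "compact std_triangle"
  unfolding std_triangle_eq by (intro finite_imp_compact_convex_hull) auto

lemma compact_region: "compact (region T)"
  by (cases T) (auto intro: finite_imp_compact_convex_hull)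

lemma area_eq: "area (A, B, C) = \<bar>cross2 (B - A) (C - A)\<bar> / 2"
  unfolding area_def region.simps content_triangle cross2_def
  by (simp add: abs_minus_commute algebra_simps)

lemma collinear_0_iff_cross2: "collinear {0, u, v} \<longleftrightarrow> cross2 u v = 0"
proof
  assume "collinear {0, u, v}"
  then show "cross2 u v = 0"
    by (auto simp: collinear_lemma cross2_def)
next
  assume D: "cross2 u v = 0"
  show "collinear {0, u, v}"
  proof (cases "u = 0")
    case False
    then have "u $ 1 \<noteq> 0 \<or> u $ 2 \<noteq> 0" by (auto simp: vec_eq_iff forall_2)
    then have "\<exists>c. v = c *\<^sub>R u"
    proof
      assume "u $ 1 \<noteq> 0"
      then show ?thesis using D
        by (intro exI[of _ "v $ 1 / u $ 1"]) (auto simp: cross2_def vec_eq_iff forall_2 field_simps)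
    next
      assume "u $ 2 \<noteq> 0"
      then show ?thesis using D
        by (intro exI[of _ "v $ 2 / u $ 2"]) (auto simp: cross2_def vec_eq_iff forall_2 field_simps)
    qed
    then show ?thesis by (auto simp: collinear_lemma)
  qed (auto simp: collinear_lemma)
qed

lemma nondegenerate_iff: "nondegenerate (A, B, C) \<longleftrightarrow> cross2 (B - A) (C - A) \<noteq> 0"
  using collinear_3[of B A C] by (simp add: insert_commute collinear_0_iff_cross2)

text \<open>Affine change of variables: the map from the standard triangle has constant Jacobian determinant
  \<open>cross2 (B - A) (C - A)\<close>, that is, up to sign, twice the area of the image.\<close>

lemma integral_region:
  fixes f :: "point \<Rightarrow> real"
  assumes nd: "nondegenerate T" and cont: "continuous_on UNIV f"
  shows "integral (region T) f = 2 * area T * integral std_triangle (\<lambda>x. f (barycentric_point T x))"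
proof -
  obtain A B C where T: "T = (A, B, C)" by (cases T)
  define u v where "u = B - A" and "v = C - A"
  define g where "g = barycentric_point T"
  define g' where "g' = (\<lambda>x::point. (x $ 1) *\<^sub>R u + (x $ 2) *\<^sub>R v)"
  have gA: "g = (\<lambda>x. A + g' x)"
    by (auto simp: g_def g'_def T barycentric_point_def u_def v_def)
  have lin: "linear g'"
    by (auto simp: g'_def linear_iff algebra_simps)
  have det: "det (matrix g') = cross2 u v"
    by (simp add: det_2 matrix_def g'_def cross2_def axis_def)
  have D: "cross2 u v \<noteq> 0" using nd unfolding T nondegenerate_iff u_def v_def .
  have der: "(g has_derivative g') (at x within std_triangle)" for x
    unfolding gA using linear_imp_has_derivative[OF lin] by (auto intro!: derivative_eq_intros)
  have inj: "inj_on g std_triangle"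
    using D det det_nz_iff_inj[OF lin] by (auto simp: gA inj_on_def inj_def)
  \<comment> \<open>The change of variables theorem concerns functions with values in \<open>real^'n\<close>; a real
    function enters as a vector with one entry.\<close>
  define F :: "point \<Rightarrow> real^1" where "F = (\<lambda>x. vec (f x))"
  have regl: "region T \<in> sets lebesgue"
    using compact_region by (simp add: compact_imp_closed)
  obtain a b where ab: "region T \<subseteq> cbox a b"
    using bounded_subset_cbox_symmetric compact_imp_bounded[OF compact_region] by metis
  have "f absolutely_integrable_on cbox a b"
    using cont continuous_on_subset by (blast intro: absolutely_integrable_continuous)
  then have "f absolutely_integrable_on region T"
    by (rule set_integrable_subset[OF _ regl ab])
  then have "F absolutely_integrable_on (g ` std_triangle)"
    by (simp add: F_def absolutely_integrable_on_1_iff g_def region_eq_image)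
  then have "integral std_triangle (\<lambda>x. \<bar>det (matrix g')\<bar> *\<^sub>R F (g x)) = integral (g ` std_triangle) F \<and>
      (\<lambda>x. \<bar>det (matrix g')\<bar> *\<^sub>R F (g x)) absolutely_integrable_on std_triangle"
    using has_absolute_integral_change_of_variables_compact[OF compact_std_triangle der inj] by blast
  then have "integral (g ` std_triangle) f = integral std_triangle (\<lambda>x. \<bar>cross2 u v\<bar> * f (g x))"
    by (simp add: integral_on_1_eq F_def det vec_eq_iff)
  then show ?thesis
    by (simp add: g_def region_eq_image T area_eq u_def v_def)
qed


section \<open>The interpolation error of a quadratic function\<close>

text \<open>The integral over the standard triangle of the product of two barycentric coordinates, equal
  to \<open>1/24\<close>.  Decision values can be compared because it is positive and the same for each pair of
  coordinates.\<close>

definition moment :: real where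
  "moment = integral std_triangle (\<lambda>x. x $ 1 * x $ 2)"

lemma nondegenerate_std_vertex_orders:
  "nondegenerate (axis 1 1, axis 2 1, 0)"
  "nondegenerate (axis 1 1, 0, axis 2 1)"
  by (simp_all only: nondegenerate_iff) (simp_all add: cross2_def axis_def)

text \<open>An affine map that permutes the vertices of the standard triangle preserves area and permutes
  the barycentric coordinates, so all three pairs have the same integral.\<close>

lemma moment_sym:
  "integral std_triangle (\<lambda>x. x $ 1 * (1 - x $ 1 - x $ 2)) = moment"
  "integral std_triangle (\<lambda>x. x $ 2 * (1 - x $ 1 - x $ 2)) = moment"
proof -
  have *: "continuous_on UNIV (\<lambda>x::point. x $ 1 * x $ 2)"
    by (intro continuous_intros)
  have r: "region (axis 1 1, axis 2 1, 0) = std_triangle" "region (axis 1 1, 0, axis 2 1) = std_triangle"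
    unfolding std_triangle_eq by (simp_all add: insert_commute)
  show "integral std_triangle (\<lambda>x. x $ 1 * (1 - x $ 1 - x $ 2)) = moment"
    using integral_region[OF nondegenerate_std_vertex_orders(1) *] unfolding r
    by (simp add: moment_def area_eq cross2_def axis_def barycentric_point_def algebra_simps)
  show "integral std_triangle (\<lambda>x. x $ 2 * (1 - x $ 1 - x $ 2)) = moment"
    using integral_region[OF nondegenerate_std_vertex_orders(2) *] unfolding r
    by (simp add: moment_def area_eq cross2_def axis_def barycentric_point_def algebra_simps)
qed

lemma integrable_std: "continuous_on UNIV f \<Longrightarrow> f integrable_on std_triangle" for f :: "point \<Rightarrow> real"
proof -
  assume f: "continuous_on UNIV f"
  then have "set_integrable lborel std_triangle f"
    unfolding set_integrable_def
    by (intro borel_integrable_compact compact_std_triangle) (auto intro: continuous_on_subset)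
  then show ?thesis by (rule set_borel_integral_eq_integral)
qed

text \<open>The integrand is nonnegative on the triangle, and at least \<open>1/16\<close> on the square
  \<open>[1/4, 1/2] \<times> [1/4, 1/2]\<close> inside it.\<close>

lemma moment_pos: "moment > 0"
proof -
  define Q where "Q = cbox (vector [1/4, 1/4]) (vector [1/2, 1/2] :: point)"
  have Q: "x \<in> Q \<longleftrightarrow> 1/4 \<le> x $ 1 \<and> x $ 1 \<le> 1/2 \<and> 1/4 \<le> x $ 2 \<and> x $ 2 \<le> 1/2" for x
    by (auto simp: Q_def mem_box_cart forall_2)
  have "0 < measure lborel Q"
    unfolding Q_def by (subst content_pos_lt_eq) (auto simp: Basis_vec_def inner_axis forall_2)
  then have "0 < integral Q (\<lambda>x. 1/16 :: real)"
    by (simp add: Q_def)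
  also have "\<dots> \<le> integral Q (\<lambda>x. x $ 1 * x $ 2)"
  proof (rule integral_le)
    show "(\<lambda>x. x $ 1 * x $ 2) integrable_on Q" unfolding Q_def
      by (intro integrable_continuous continuous_intros)
    show "1/16 \<le> x $ 1 * x $ 2" if "x \<in> Q" for x
      using mult_mono[of "1/4" "x $ 1" "1/4" "x $ 2"] that by (simp add: Q)
  qed (simp add: Q_def integrable_const)
  also have "\<dots> \<le> moment" unfolding moment_def
  proof (rule integral_subset_le)
    show "(\<lambda>x. x $ 1 * x $ 2) integrable_on Q" unfolding Q_def
      by (intro integrable_continuous continuous_intros)
    show "(\<lambda>x. x $ 1 * x $ 2) integrable_on std_triangle"
      by (intro integrable_std continuous_intros)
  qed (auto simp: Q std_triangle_def)
  finally show ?thesis .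
qed

text \<open>Everything that follows depends on a triangle only through its area and the multiset of its
  squared edge lengths; passing to the multiset removes the bookkeeping of vertex orders.\<close>

definition sq_edges :: "quad_poly \<Rightarrow> triangle \<Rightarrow> real multiset" where
  "sq_edges q T = mset (map (quad_form q) (edge_vectors T))"

lemma affine_interpolant:
  assumes "nondegenerate S"
  shows "affine_fun (affine_interpolant f S)" "interpolates (affine_interpolant f S) f S"
  using theI'[OF ex1_affine_interpolant[OF assms, of f]] by (simp_all add: affine_interpolant_def)

text \<open>On the vertices \<open>v i\<close> with weights \<open>l i\<close> of sum \<open>1\<close>, an affine function is averaged exactly,
  whereas a quadratic one falls short of its average by the sum of \<open>l i * l j * q (v i - v j)\<close> over
  the pairs, where \<open>q\<close> is the quadratic form.  In particular the error of interpolating a convex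
  quadratic has constant sign, which makes its \<open>L\<^sup>1\<close> norm a plain integral.\<close>

lemma interpolation_error:
  assumes "nondegenerate (A, B, C)"
  shows "affine_interpolant (poly_fun q) (A, B, C) (barycentric_point (A, B, C) x)
      - poly_fun q (barycentric_point (A, B, C) x)
    = x $ 1 * (1 - x $ 1 - x $ 2) * quad_form q (B - A) + x $ 1 * x $ 2 * quad_form q (C - B)
      + x $ 2 * (1 - x $ 1 - x $ 2) * quad_form q (A - C)"
proof -
  define g where "g = affine_interpolant (poly_fun q) (A, B, C)"
  obtain w d where w: "\<And>x. g x = w \<bullet> x + d"
    using affine_interpolant(1)[OF assms] unfolding affine_fun_def g_def by blast
  have v: "g A = poly_fun q A" "g B = poly_fun q B" "g C = poly_fun q C"
    using affine_interpolant(2)[OF assms] unfolding g_def by auto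
  have eq: "g (barycentric_point (A, B, C) x) = (1 - x $ 1 - x $ 2) * g A + x $ 1 * g B + x $ 2 * g C"
    by (simp add: w barycentric_point_def algebra_simps)
  show ?thesis unfolding g_def[symmetric] eq v
    unfolding poly_fun_def quad_form_def barycentric_point_def
    by (simp add: power2_eq_square) algebra
qed

lemma quad_form_nonneg: "pos_definite q \<Longrightarrow> 0 \<le> quad_form q v"
  by (cases "v = 0") (auto simp: pos_definite_def quad_form_def less_imp_le)

lemma L1_error_eq:
  assumes nd: "nondegenerate S" and pd: "pos_definite q"
  shows "L1_error (poly_fun q) S = 2 * moment * area S * sum_mset (sq_edges q S)"
proof -
  obtain A B C where S: "S = (A, B, C)" by (cases S)
  define h where "h = (\<lambda>x. \<bar>poly_fun q x - affine_interpolant (poly_fun q) S x\<bar>)"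
  obtain w d where w: "\<And>x. affine_interpolant (poly_fun q) S x = w \<bullet> x + d"
    using affine_interpolant(1)[OF nd] unfolding affine_fun_def by blast
  have cont: "continuous_on UNIV h"
    unfolding h_def w poly_fun_def by (intro continuous_intros)
  have "set_integrable lborel (region S) h"
    unfolding set_integrable_def
    by (intro borel_integrable_compact compact_region) (auto intro: continuous_on_subset[OF cont])
  then have "L1_error (poly_fun q) S = integral (region S) h"
    unfolding L1_error_def h_def by (rule set_borel_integral_eq_integral)
  also have "\<dots> = 2 * area S * integral std_triangle (\<lambda>x. h (barycentric_point S x))"
    by (rule integral_region[OF nd cont])
  also have "integral std_triangle (\<lambda>x. h (barycentric_point S x)) =
      integral std_triangle (\<lambda>x. x $ 1 * (1 - x $ 1 - x $ 2) * quad_form q (B - A)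
      + x $ 1 * x $ 2 * quad_form q (C - B)
      + x $ 2 * (1 - x $ 1 - x $ 2) * quad_form q (A - C))" (is "_ = integral _ ?p")
  proof (rule integral_cong)
    fix x :: point assume x: "x \<in> std_triangle"
    have "h (barycentric_point S x) = \<bar>?p x\<bar>"
      using interpolation_error[of A B C q x] nd unfolding h_def S by (simp add: abs_minus_commute)
    moreover have "?p x \<ge> 0"
      using x quad_form_nonneg[OF pd] by (intro add_nonneg_nonneg mult_nonneg_nonneg) (auto simp: std_triangle_def)
    ultimately show "h (barycentric_point S x) = ?p x" by simp
  qed
  also have "\<dots> = moment * quad_form q (B - A) + moment * quad_form q (C - B) + moment * quad_form q (A - C)"
    by (subst integral_add integral_mult_left;
      (intro integrable_add integrable_std continuous_intros)?)+
      (simp add: moment_sym moment_def[symmetric])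
  finally show ?thesis
    by (simp add: S sq_edges_def algebra_simps)
qed

section \<open>The shape measure in terms of squared edge lengths\<close>

text \<open>The area with respect to the Euclidean structure given by the quadratic form.\<close>

definition quad_area :: "quad_poly \<Rightarrow> triangle \<Rightarrow> real" where
  "quad_area q T = area T * sqrt (quad_det q)"

text \<open>Evaluate the form at \<open>(1, 0)\<close> and at \<open>(- a11, a20)\<close>; the second value is \<open>a20\<close> times the
  determinant.\<close>

lemma quad_det_pos:
  assumes "pos_definite q"
  shows "0 < quad_det q"
proof -
  have "0 < quad_form q (vector [1, 0])"
    using assms unfolding pos_definite_def by (auto simp: vec_eq_iff forall_2)
  then have a: "0 < a20 q" by (simp add: quad_form_def)
  then have "vector [- a11 q, a20 q] \<noteq> (0 :: point)"
    by (auto simp: vec_eq_iff forall_2)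
  then have "0 < quad_form q (vector [- a11 q, a20 q])"
    using assms unfolding pos_definite_def by blast
  also have "\<dots> = a20 q * quad_det q"
    by (simp add: quad_form_def quad_det_def power2_eq_square) algebra
  finally show ?thesis using a by (simp add: zero_less_mult_iff)
qed

lemma quad_area_pos: "nondegenerate T \<Longrightarrow> pos_definite q \<Longrightarrow> 0 < quad_area q T"
  using quad_det_pos[of q] by (cases T) (auto simp: quad_area_def area_eq nondegenerate_iff simp del: nondegenerate.simps)

text \<open>Heron's formula in the metric of \<open>q\<close>.  It is written symmetrically in the squared lengths, so
  that it makes sense for a multiset.\<close>

lemma quad_heron:
  assumes "pos_definite q"
  shows "16 * (quad_area q T)\<^sup>2 =
    (sum_mset (sq_edges q T))\<^sup>2 - 2 * sum_mset (image_mset (\<lambda>x. x\<^sup>2) (sq_edges q T))"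
proof -
  obtain A B C where T: "T = (A, B, C)" by (cases T)
  have "16 * (quad_area q T)\<^sup>2 = 4 * (cross2 (B - A) (C - A))\<^sup>2 * quad_det q"
    using quad_det_pos[OF assms] by (simp add: T quad_area_def area_eq power_mult_distrib power_divide)
  then show ?thesis
    by (simp add: T sq_edges_def cross2_def quad_det_def quad_form_def power2_eq_square) algebra
qed

lemma shape_measure_eq_sq_edges:
  assumes pd: "pos_definite q"
  shows "shape_measure q T =
    (sum_mset (sq_edges q T) - Max (set_mset (sq_edges q T))) / (4 * quad_area q T)"
proof -
  obtain x y z where xyz: "edge_vectors T = [x, y, z]" by (cases T) auto
  have main: "shape_measure q T = (sum_mset (sq_edges q T) - Max (set_mset (sq_edges q T))) / (4 * quad_area q T)"
    if "mset [a, b, c] = mset (edge_vectors T)" "quad_form q b \<le> quad_form q a" "quad_form q c \<le> quad_form q b"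
    for a b c
  proof -
    have E: "sq_edges q T = {#quad_form q a, quad_form q b, quad_form q c#}"
      unfolding sq_edges_def mset_map that(1)[symmetric] by simp
    have "Max {quad_form q a, quad_form q b, quad_form q c} = quad_form q a"
      using that by (intro Max_eqI) auto
    then show ?thesis
      using that by (subst shape_measure_eq[OF that(1)]) (auto simp: E quad_area_def quad_norm_def algebra_simps)
  qed
  note p = xyz add_mset_commute
  consider "quad_form q y \<le> quad_form q x" "quad_form q z \<le> quad_form q y"
    | "quad_form q z \<le> quad_form q x" "quad_form q y \<le> quad_form q z"
    | "quad_form q x \<le> quad_form q y" "quad_form q z \<le> quad_form q x"
    | "quad_form q z \<le> quad_form q y" "quad_form q x \<le> quad_form q z"
    | "quad_form q x \<le> quad_form q z" "quad_form q y \<le> quad_form q x"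
    | "quad_form q y \<le> quad_form q z" "quad_form q x \<le> quad_form q y"
    by linarith
  then show ?thesis
  proof cases
    case 1 then show ?thesis by (intro main[of x y z]) (simp_all add: p)
  next
    case 2 then show ?thesis by (intro main[of x z y]) (simp_all add: p)
  next
    case 3 then show ?thesis by (intro main[of y x z]) (simp_all add: p)
  next
    case 4 then show ?thesis by (intro main[of y z x]) (simp_all add: p)
  next
    case 5 then show ?thesis by (intro main[of z x y]) (simp_all add: p)
  next
    case 6 then show ?thesis by (intro main[of z y x]) (simp_all add: p)
  qed
qed

text \<open>Removing any edge, not only the longest one, leaves an upper bound for the shape measure.  This
  avoids having to know which edge of a descendant is the longest.\<close>

lemma shape_measure_le:
  assumes "nondegenerate T" "pos_definite q" "sq_edges q T = {#a, b, c#}"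
  shows "4 * quad_area q T * shape_measure q T \<le> b + c"
proof -
  have "a \<le> Max {a, b, c}" by simp
  then show ?thesis
    using quad_area_pos[OF assms(1,2)] by (simp add: shape_measure_eq_sq_edges[OF assms(2)] assms(3))
qed

lemma shape_measure_longest:
  assumes "nondegenerate T" "pos_definite q" "sq_edges q T = {#a, b, c#}" "b \<le> a" "c \<le> a"
  shows "4 * quad_area q T * shape_measure q T = b + c"
proof -
  have "Max {a, b, c} = a" using assms by (intro Max_eqI) auto
  then show ?thesis
    using quad_area_pos[OF assms(1,2)] by (simp add: shape_measure_eq_sq_edges[OF assms(2)] assms(3))
qed

section \<open>The greedy choice\<close>

lemma midpoint_nth: "midpoint A B $ i = (A $ i + B $ i) / 2"
  for A B :: point
  by (simp add: midpoint_def)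

lemma quad_form_scaleR: "quad_form q (r *\<^sub>R v) = r\<^sup>2 * quad_form q v"
  by (simp add: quad_form_def power_mult_distrib algebra_simps power2_eq_square)
lemma quad_form_parallelogram: "quad_form q (u + v) + quad_form q (u - v) = 2 * quad_form q u + 2 * quad_form q v"
  by (simp add: quad_form_def power2_eq_square algebra_simps)
lemma quad_form_minus: "quad_form q (- v) = quad_form q v"
  by (simp add: quad_form_def)

lemma quad_form_midpoint:
  "quad_form q (midpoint A B - A) = quad_form q (B - A) / 4"
  "quad_form q (B - midpoint A B) = quad_form q (B - A) / 4"
  "quad_form q (C - midpoint A B) = (2 * quad_form q (C - B) + 2 * quad_form q (A - C) - quad_form q (B - A)) / 4"
  "quad_form q (midpoint A B - C) = (2 * quad_form q (C - B) + 2 * quad_form q (A - C) - quad_form q (B - A)) / 4"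
proof -
  have 1: "midpoint A B - A = (1/2) *\<^sub>R (B - A)" "B - midpoint A B = (1/2) *\<^sub>R (B - A)"
    by (simp_all add: vec_eq_iff midpoint_nth field_simps)
  have 2: "C - midpoint A B = (1/2) *\<^sub>R ((C - B) - (A - C))"
    by (simp add: vec_eq_iff midpoint_nth field_simps)
  have 3: "(C - B) + (A - C) = - (B - A)" by simp
  show "quad_form q (midpoint A B - A) = quad_form q (B - A) / 4"
    "quad_form q (B - midpoint A B) = quad_form q (B - A) / 4"
    unfolding 1 quad_form_scaleR by (simp_all add: power2_eq_square)
  show 4: "quad_form q (C - midpoint A B) = (2 * quad_form q (C - B) + 2 * quad_form q (A - C) - quad_form q (B - A)) / 4"
    using quad_form_parallelogram[of q "C - B" "A - C"] unfolding 3 quad_form_minus unfolding 2 quad_form_scaleR by (simp add: power2_eq_square)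
  show "quad_form q (midpoint A B - C) = (2 * quad_form q (C - B) + 2 * quad_form q (A - C) - quad_form q (B - A)) / 4"
    using 4 quad_form_minus[of q "C - midpoint A B"] by simp
qed

lemma cross2_midpoint:
  "cross2 (midpoint A B - A) (C - A) = cross2 (B - A) (C - A) / 2"
  "cross2 (B - midpoint A B) (C - midpoint A B) = cross2 (B - A) (C - A) / 2"
  unfolding cross2_def vector_minus_component midpoint_nth by (simp_all add: field_simps)

lemma cross2_rotate: "cross2 (C - B) (A - B) = cross2 (B - A) (C - A)"
  unfolding cross2_def vector_minus_component by algebra

lemma child_area:
  "area (child1 e) = area e / 2" "area (child2 e) = area e / 2"
  by (cases e; simp add: area_eq cross2_midpoint)+

lemma child_nondegenerate:
  assumes "nondegenerate e"
  shows "nondegenerate (child1 e)" "nondegenerate (child2 e)"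
  using assms
  by (cases e; simp add: nondegenerate_iff cross2_midpoint del: nondegenerate.simps)+

text \<open>The squared length \<open>(2 * b + 2 * c - a) / 4\<close> is that of the median which bisects the edge of
  squared length \<open>a\<close>.\<close>

lemma child_sq_edges:
  fixes A B C q
  defines "a \<equiv> quad_form q (B - A)" and "b \<equiv> quad_form q (C - B)" and "c \<equiv> quad_form q (A - C)"
  shows "sq_edges q (child1 (A, B, C)) = {#a / 4, c, (2 * b + 2 * c - a) / 4#}"
    and "sq_edges q (child2 (A, B, C)) = {#a / 4, b, (2 * b + 2 * c - a) / 4#}"
  by (simp_all add: a_def b_def c_def sq_edges_def quad_form_midpoint add_mset_commute)

lemma edge_choice:
  assumes "e \<in> edge_choices T"
  shows "sq_edges q e = sq_edges q T" "area e = area T" "nondegenerate e = nondegenerate T"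
  using assms
  by (cases T; auto simp: sq_edges_def area_eq nondegenerate_iff cross2_rotate add_mset_commute
      simp del: nondegenerate.simps)+

text \<open>By the formula for the median the squared lengths in both children add up to
  \<open>2 * (b + c)\<close>, where \<open>a\<close> is the bisected edge; the decision function is therefore smallest
  for the longest edge.\<close>

lemma decision_eq:
  assumes "nondegenerate (A, B, C)" and pd: "pos_definite q"
  shows "decision (poly_fun q) (A, B, C) =
    2 * moment * area (A, B, C) * (sum_mset (sq_edges q (A, B, C)) - quad_form q (B - A))"
  unfolding decision_def L1_error_eq[OF child_nondegenerate(1)[OF assms(1)] pd]
    L1_error_eq[OF child_nondegenerate(2)[OF assms(1)] pd] child_area child_sq_edges
  by (simp add: sq_edges_def field_simps)

text \<open>The greedy procedure bisects an edge that is longest in the metric of \<open>q\<close>.  This is all that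
  is needed about the procedure; the rest of the argument only manipulates edge multisets.\<close>

lemma greedy_bisection_longest:
  assumes nd: "nondegenerate T" and pd: "pos_definite q"
    and greedy: "greedy_bisection (poly_fun q) T S1 S2"
  obtains a b c where "sq_edges q T = {#a, b, c#}" "b \<le> a" "c \<le> a"
    "sq_edges q S1 = {#a / 4, c, (2 * b + 2 * c - a) / 4#}"
    "sq_edges q S2 = {#a / 4, b, (2 * b + 2 * c - a) / 4#}"
    "nondegenerate S1" "nondegenerate S2"
    "quad_area q S1 = quad_area q T / 2" "quad_area q S2 = quad_area q T / 2"
proof -
  obtain e where e: "e \<in> edge_choices T" "\<And>e'. e' \<in> edge_choices T \<Longrightarrow> decision (poly_fun q) e \<le> decision (poly_fun q) e'"
    "S1 = child1 e" "S2 = child2 e"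
    using greedy unfolding greedy_bisection_def by blast
  obtain A B C where ABC: "e = (A, B, C)" by (cases e)
  define a b c where "a = quad_form q (B - A)" and "b = quad_form q (C - B)" and "c = quad_form q (A - C)"
  have nde: "nondegenerate (A, B, C)" using edge_choice(3)[OF e(1)] nd ABC by simp
  have le: "quad_form q (B' - A') \<le> a" if e': "(A', B', C') \<in> edge_choices T" for A' B' C'
  proof -
    have nde': "nondegenerate (A', B', C')" using edge_choice(3)[OF e'] nd by simp
    have ar: "area (A', B', C') = area T" "area (A, B, C) = area T"
      "sq_edges q (A', B', C') = sq_edges q T" "sq_edges q (A, B, C) = sq_edges q T"
      using edge_choice[OF e'] edge_choice[OF e(1)] ABC by simp_all
    have "0 < area T" using nd by (cases T) (auto simp: area_eq nondegenerate_iff simp del: nondegenerate.simps)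
    then have "0 < 2 * moment * area T" using moment_pos by simp
    then show ?thesis
      using e(2)[OF e'] unfolding ABC decision_eq[OF nde pd] decision_eq[OF nde' pd] ar a_def
      by (simp only: mult_le_cancel_left_pos)
  qed
  have "(B, C, A) \<in> edge_choices T" "(C, A, B) \<in> edge_choices T"
    using e(1) unfolding ABC by (cases T; auto)+
  then have "b \<le> a" "c \<le> a" unfolding b_def c_def by (auto intro: le)
  moreover have "sq_edges q T = {#a, b, c#}"
    using edge_choice(1)[OF e(1)] by (simp add: ABC sq_edges_def a_def b_def c_def)
  ultimately show ?thesis
    using child_sq_edges[where A=A and B=B and C=C and q=q] child_nondegenerate[OF nde] child_area[of e] edge_choice(2)[OF e(1)]
    by (intro that[of a b c]) (simp_all add: e(3,4) ABC a_def b_def c_def quad_area_def)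
qed

section \<open>The shape measure under refinement\<close>

lemma sq_edges_nonneg: "pos_definite q \<Longrightarrow> x \<in># sq_edges q T \<Longrightarrow> 0 \<le> x"
  by (auto simp: sq_edges_def quad_form_nonneg)

text \<open>Dropping in a child the edge that it shares with its parent leaves half of the bisected edge and
  the median, and \<open>a / 4 + (2 * b + 2 * c - a) / 4 = (b + c) / 2\<close>.  Since the area halves as well,
  the shape measure cannot grow.\<close>

lemma shape_measure_antimono:
  assumes nd: "nondegenerate T" and pd: "pos_definite q"
    and greedy: "greedy_bisection (poly_fun q) T S1 S2" and S: "S \<in> {S1, S2}"
  shows "shape_measure q S \<le> shape_measure q T" and "nondegenerate S"
proof -
  obtain a b c where T: "sq_edges q T = {#a, b, c#}" "b \<le> a" "c \<le> a"
    and S12: "sq_edges q S1 = {#a / 4, c, (2 * b + 2 * c - a) / 4#}"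
    "sq_edges q S2 = {#a / 4, b, (2 * b + 2 * c - a) / 4#}"
    "nondegenerate S1" "nondegenerate S2"
    "quad_area q S1 = quad_area q T / 2" "quad_area q S2 = quad_area q T / 2"
    using greedy_bisection_longest[OF nd pd greedy] .
  show ndS: "nondegenerate S" using S S12 by auto
  have "\<exists>x. sq_edges q S = {#x, a / 4, (2 * b + 2 * c - a) / 4#}"
    using S S12(1,2) by (auto simp: add_mset_commute)
  then have "4 * quad_area q S * shape_measure q S \<le> a / 4 + (2 * b + 2 * c - a) / 4"
    using shape_measure_le[OF ndS pd] by blast
  moreover have "quad_area q S = quad_area q T / 2" using S S12 by auto
  ultimately have "4 * quad_area q T * shape_measure q S \<le> 4 * quad_area q T * shape_measure q T"
    using shape_measure_longest[OF nd pd T] by (simp add: field_simps)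
  then show "shape_measure q S \<le> shape_measure q T"
    using quad_area_pos[OF nd pd] by simp
qed

text \<open>A strictly longest edge leaves no freedom to the procedure.  Of the two children the one with
  the edge \<open>z\<close> is returned.\<close>

lemma bisect_strictly_longest:
  assumes nd: "nondegenerate S" and pd: "pos_definite q"
    and greedy: "greedy_bisection (poly_fun q) S U1 U2"
    and S: "sq_edges q S = {#x, y, z#}" and less: "x < y" "z < y"
  obtains U where "U \<in> {U1, U2}" "sq_edges q U = {#y / 4, z, (2 * x + 2 * z - y) / 4#}"
    "quad_area q U = quad_area q S / 2"
proof -
  obtain a b c where T: "sq_edges q S = {#a, b, c#}" "b \<le> a" "c \<le> a"
    and S12: "sq_edges q U1 = {#a / 4, c, (2 * b + 2 * c - a) / 4#}"
    "sq_edges q U2 = {#a / 4, b, (2 * b + 2 * c - a) / 4#}"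
    "quad_area q U1 = quad_area q S / 2" "quad_area q U2 = quad_area q S / 2"
    using greedy_bisection_longest[OF nd pd greedy] .
  have "set_mset {#a, b, c#} = set_mset {#x, y, z#}" using S T(1) by simp
  then have "y \<in> {a, b, c}" "a \<in> {x, y, z}" by auto
  then have y: "a = y" using less T(2,3) by auto
  have "{#y, b, c#} = {#y, x, z#}"
    using S T(1) by (simp add: y add_mset_commute)
  then have "{#b, c#} = {#x, z#}" by simp
  then have "b = x \<and> c = z \<or> b = z \<and> c = x"
    by (auto simp: add_eq_conv_ex)
  then show ?thesis
  proof
    assume "b = x \<and> c = z"
    then show ?thesis using S12 y by (intro that[of U1]) auto
  next
    assume "b = z \<and> c = x"
    then show ?thesis using S12 y by (intro that[of U2]) (auto simp: add.commute)
  qed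
qed

lemma quad_heron3:
  assumes "pos_definite q" "sq_edges q T = {#a, b, c#}"
  shows "16 * (quad_area q T)\<^sup>2 = 4 * b * c - (a - b - c)\<^sup>2"
  using quad_heron[OF assms(1), of T] unfolding assms(2) by (simp add: power2_eq_square algebra_simps)

text \<open>For squared lengths \<open>a \<ge> b \<ge> c\<close>, the hypothesis says that the shape measure is at least
  \<open>5\<close>.  The left-hand sides of the two alternatives bound, in the scale of the parent, the shape
  measure of the child at \<open>c\<close> and that of a grandchild below the child at \<open>b\<close>.  For a completely
  flat triangle, \<open>b\<close> and \<open>c\<close> are \<open>t\<^sup>2\<close> and \<open>(1 - t)\<^sup>2\<close> for \<open>a = 1\<close>, and the first alternative
  holds unless \<open>t\<close> is near \<open>1/2\<close>, when the second one does.

  If both alternatives fail, \<open>(a, b, c)\<close> lies in the convex polyhedral cone given by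
  \<open>l > 0\<close>, \<open>m > 0\<close>, \<open>b \<ge> c\<close>, \<open>a \<ge> b\<close>, well inside the cone on which the quadratic form
  \<open>4 * b * c - (a - b - c)\<^sup>2 - (b + c)\<^sup>2 / 25\<close> is positive.  The positivity is certified by writing
  this form as a combination of products of the four linear forms with positive coefficients.\<close>

lemma thin_triangle_inequality:
  fixes a b c :: real
  assumes "b \<le> a" "c \<le> b" and thin: "25 * (4 * b * c - (a - b - c)\<^sup>2) \<le> (b + c)\<^sup>2"
  shows "b + 3 * c - a / 2 \<le> 0.69 * (b + c) \<or> 2 * b + 3 * c - a \<le> 0.69 * (b + c)"
proof (rule ccontr)
  define l where "l = 31 * b + 231 * c - 50 * a"
  define m where "m = 131 * b + 231 * c - 100 * a"
  assume "\<not> ?thesis"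
  then have lm: "0 < l" "0 < m" by (simp_all add: l_def m_def)
  have "0 < 71/1123600 * (l * l) + 461/22472 * (l * (b - c)) + 57253/15168600 * (l * (a - b))
    + 1387/143100 * (m * (a - b)) + 14695/44944 * ((b - c) * (b - c)) + 136903/202248 * ((b - c) * (a - b))"
    using assms(1,2) lm by (intro add_pos_nonneg mult_pos_pos mult_nonneg_nonneg) simp_all
  also have "\<dots> = 4 * b * c - (a - b - c)\<^sup>2 - (b + c)\<^sup>2 / 25"
    unfolding l_def m_def power2_eq_square by (simp add: field_simps)
  finally show False using thin by simp
qed

text \<open>The case in which the child \<open>S\<close> contains the shorter edge \<open>c\<close> and the child \<open>L\<close> the longer
  edge \<open>b\<close>.\<close>

lemma grandchild_shape_reduction_aux:
  assumes nd: "nondegenerate T" "nondegenerate S" "nondegenerate L" and pd: "pos_definite q"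
    and T: "sq_edges q T = {#a, b, c#}" "b \<le> a" "c \<le> b"
    and S: "sq_edges q S = {#a / 4, c, (2 * b + 2 * c - a) / 4#}" "quad_area q S = quad_area q T / 2"
    and L: "sq_edges q L = {#a / 4, b, (2 * b + 2 * c - a) / 4#}" "quad_area q L = quad_area q T / 2"
    and greedy: "greedy_bisection (poly_fun q) L U1 U2"
    and thin: "5 \<le> shape_measure q T"
  shows "shape_measure q S \<le> 0.69 * shape_measure q T \<or>
    (\<exists>U \<in> {U1, U2}. shape_measure q U \<le> 0.69 * shape_measure q T)"
proof -
  have N: "0 < quad_area q T" by (rule quad_area_pos[OF nd(1) pd])
  have sT: "4 * quad_area q T * shape_measure q T = b + c"
    using shape_measure_longest[OF nd(1) pd T(1)] T by simp
  have heron: "16 * (quad_area q T)\<^sup>2 = 4 * b * c - (a - b - c)\<^sup>2"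
    by (rule quad_heron3[OF pd T(1)])
  have nonneg: "0 \<le> c" using sq_edges_nonneg[OF pd, of c T] T(1) by simp
  \<comment> \<open>By Heron's formula, shape measure at least \<open>5\<close> becomes a condition on the lengths alone.\<close>
  have "20 * quad_area q T \<le> b + c"
    using mult_left_mono[OF thin, of "4 * quad_area q T"] N sT by simp
  then have "(20 * quad_area q T)\<^sup>2 \<le> (b + c)\<^sup>2" using N by (intro power_mono) auto
  then have "25 * (4 * b * c - (a - b - c)\<^sup>2) \<le> (b + c)\<^sup>2"
    unfolding heron[symmetric] by (simp add: power_mult_distrib)
  from thin_triangle_inequality[OF T(2,3) this] show ?thesis
  proof
    assume *: "b + 3 * c - a / 2 \<le> 0.69 * (b + c)"
    have "4 * quad_area q S * shape_measure q S \<le> c + (2 * b + 2 * c - a) / 4"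
      by (rule shape_measure_le[OF nd(2) pd S(1)])
    then have "4 * quad_area q T * shape_measure q S \<le> 4 * quad_area q T * (0.69 * shape_measure q T)"
      using * sT S(2) by (simp add: field_simps)
    then show ?thesis using N by simp
  next
    assume *: "2 * b + 3 * c - a \<le> 0.69 * (b + c)"
    \<comment> \<open>In \<open>L\<close> the edge \<open>b\<close> is strictly the longest, so the next bisection must cut it.\<close>
    have b: "a / 4 < b"
    proof (rule ccontr)
      assume "\<not> a / 4 < b"
      then have "2 * b \<le> a - b - c" "2 * c \<le> a - b - c" using T(3) by linarith+
      then have "(2 * b) * (2 * c) \<le> (a - b - c) * (a - b - c)"
        using nonneg T(3) by (intro mult_mono) auto
      then have "16 * (quad_area q T)\<^sup>2 \<le> 0"
        unfolding heron by (simp add: power2_eq_square)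
      then show False using N by simp
    qed
    have m: "(2 * b + 2 * c - a) / 4 < b" using b T(2,3) by (simp add: field_simps)
    obtain U where U: "U \<in> {U1, U2}"
      "sq_edges q U = {#b / 4, (2 * b + 2 * c - a) / 4, (2 * (a / 4) + 2 * ((2 * b + 2 * c - a) / 4) - b) / 4#}"
      "quad_area q U = quad_area q L / 2"
      using bisect_strictly_longest[OF nd(3) pd greedy L(1) b m] .
    have ndU: "nondegenerate U" by (rule shape_measure_antimono(2)[OF nd(3) pd greedy U(1)])
    have "4 * quad_area q U * shape_measure q U \<le> (2 * b + 2 * c - a) / 4 + (2 * (a / 4) + 2 * ((2 * b + 2 * c - a) / 4) - b) / 4"
      by (rule shape_measure_le[OF ndU pd U(2)])
    then have "4 * quad_area q T * shape_measure q U \<le> 4 * quad_area q T * (0.69 * shape_measure q T)"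
      using * sT L(2) U(3) by (simp add: field_simps)
    then have "shape_measure q U \<le> 0.69 * shape_measure q T" using N by simp
    then show ?thesis using U(1) by blast
  qed
qed

text \<open>A thin triangle has, two generations later, a descendant that is rounder by a factor \<open>0.69\<close>
  or less: either the child containing the shortest edge already is, and its children inherit this, or one
  child of the other child is.\<close>

lemma grandchild_shape_reduction:
  assumes nd: "nondegenerate T" and pd: "pos_definite q"
    and greedy: "greedy_bisection (poly_fun q) T S1 S2"
      "greedy_bisection (poly_fun q) S1 U1 U2" "greedy_bisection (poly_fun q) S2 V1 V2"
    and thin: "5 \<le> shape_measure q T"
  shows "\<exists>U \<in> {U1, U2, V1, V2}. shape_measure q U \<le> 0.69 * shape_measure q T"
proof -
  obtain a b c where T: "sq_edges q T = {#a, b, c#}" "b \<le> a" "c \<le> a"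
    and S12: "sq_edges q S1 = {#a / 4, c, (2 * b + 2 * c - a) / 4#}"
    "sq_edges q S2 = {#a / 4, b, (2 * b + 2 * c - a) / 4#}"
    "nondegenerate S1" "nondegenerate S2"
    "quad_area q S1 = quad_area q T / 2" "quad_area q S2 = quad_area q T / 2"
    using greedy_bisection_longest[OF nd pd greedy(1)] .
  have mono: "shape_measure q U1 \<le> shape_measure q S1" "shape_measure q V1 \<le> shape_measure q S2"
    using shape_measure_antimono(1)[OF S12(3) pd greedy(2)] shape_measure_antimono(1)[OF S12(4) pd greedy(3)] by auto
  show ?thesis
  proof (cases "c \<le> b")
    case True
    then show ?thesis
      using grandchild_shape_reduction_aux[OF nd S12(3,4) pd T(1,2) True S12(1,5,2,6) greedy(3) thin] mono
      by fastforce
  next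
    case False
    have T': "sq_edges q T = {#a, c, b#}" and S': "sq_edges q S2 = {#a / 4, b, (2 * c + 2 * b - a) / 4#}"
      "sq_edges q S1 = {#a / 4, c, (2 * c + 2 * b - a) / 4#}"
      using T(1) S12(1,2) by (simp_all add: add_mset_commute add.commute)
    show ?thesis
      using grandchild_shape_reduction_aux[OF nd S12(4,3) pd T' T(3) _ S'(1) S12(6) S'(2) S12(5) greedy(2) thin] False mono
      by fastforce
  qed
qed

section \<open>Counting thin triangles\<close>

text \<open>For \<open>p \<ge> 0\<close> at least \<open>1\<close> on the shape measures counted as bad, and growing like a power of
  the shape measure.  A factor \<open>0.69\<close> in the shape measure is then a factor \<open>0.69 powr p\<close> in the weight; the exponent
  \<open>p\<close> is chosen only at the end, according to the generation.\<close>

definition bad_weight :: "real \<Rightarrow> real \<Rightarrow> real" where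
  "bad_weight p x = (if 5 \<le> x then (x / 5) powr p else 0)"

lemma bad_weight_nonneg: "0 \<le> bad_weight p x"
  by (simp add: bad_weight_def)

lemma bad_weight_mono: "0 \<le> p \<Longrightarrow> x \<le> y \<Longrightarrow> bad_weight p x \<le> bad_weight p y"
  by (auto simp: bad_weight_def intro!: powr_mono2)

lemma bad_weight_scale:
  assumes "0 < r" "r \<le> 1"
  shows "bad_weight p (r * x) \<le> r powr p * bad_weight p x"
proof (cases "5 \<le> r * x")
  case True
  then have "0 < x" using assms by (smt (verit) zero_less_mult_iff)
  then have "r * x \<le> x" using assms mult_right_mono[of r 1 x] by simp
  then have "5 \<le> x" using True by linarith
  then show ?thesis using True assms by (simp add: bad_weight_def flip: powr_mult)
qed (simp add: bad_weight_def)

lemma sum_generation_Suc: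
  "(\<Sum>t\<in>generation (Suc n). f t) = (\<Sum>s\<in>generation n. f (False # s) + f (True # s))"
  for f :: "bool list \<Rightarrow> real"
proof -
  have "generation (Suc n) = Cons False ` generation n \<union> Cons True ` generation n"
    by (auto simp: generation_def length_Suc_conv image_iff)
  moreover have "(Cons False ` generation n) \<inter> (Cons True ` generation n) = {}" by auto
  ultimately show ?thesis
    using card_generation(1)[of n]
    by (simp add: sum.union_disjoint sum.reindex sum.distrib)
qed

context
  fixes q T R
  assumes nd: "nondegenerate T" and pd: "pos_definite q" and run: "refinement_run (poly_fun q) T R"
begin

lemma run_nondegenerate: "nondegenerate (R s)"
proof (induction s)
  case (Cons b s)
  have "greedy_bisection (poly_fun q) (R s) (R (False # s)) (R (True # s))"
    using run by (simp add: refinement_run_def)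
  from shape_measure_antimono(2)[OF Cons pd this, of "R (b # s)"] show ?case
    by (cases b) auto
qed (use nd run in \<open>simp add: refinement_run_def\<close>)

lemma run_shape_antimono: "shape_measure q (R (b # s)) \<le> shape_measure q (R s)"
proof -
  have "greedy_bisection (poly_fun q) (R s) (R (False # s)) (R (True # s))"
    using run by (simp add: refinement_run_def)
  from shape_measure_antimono(1)[OF run_nondegenerate pd this, of "R (b # s)"] show ?thesis
    by (cases b) auto
qed

definition total_bad_weight :: "real \<Rightarrow> nat \<Rightarrow> real" where
  "total_bad_weight p n = (\<Sum>s\<in>generation n. bad_weight p (shape_measure q (R s)))"

text \<open>Three of the four grandchildren weigh at most as much as their grandparent, and one weighs at
  most \<open>0.69 powr p\<close> times as much.  A triangle that is not bad has no bad descendants.\<close>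

lemma weight_grandchildren:
  fixes p :: real and s :: "bool list"
  assumes p: "0 \<le> p"
  defines "w \<equiv> \<lambda>t. bad_weight p (shape_measure q (R t))"
  shows "w (False # False # s) + w (True # False # s) + (w (False # True # s) + w (True # True # s))
    \<le> (3 + 0.69 powr p) * w s"
proof (cases "5 \<le> shape_measure q (R s)")
  case True
  have gr: "greedy_bisection (poly_fun q) (R s) (R (False # s)) (R (True # s))" for s
    using run by (simp add: refinement_run_def)
  have le: "w (b # b' # s) \<le> w s" for b b'
    using run_shape_antimono[of b "b' # s"] run_shape_antimono[of b' s] p
    unfolding w_def by (intro bad_weight_mono) auto
  obtain b b' where "shape_measure q (R (b # b' # s)) \<le> 0.69 * shape_measure q (R s)"
    using grandchild_shape_reduction[OF run_nondegenerate pd gr gr gr True] by blast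
  then have "w (b # b' # s) \<le> bad_weight p (0.69 * shape_measure q (R s))"
    unfolding w_def using p by (intro bad_weight_mono)
  also have "\<dots> \<le> 0.69 powr p * w s"
    unfolding w_def by (rule bad_weight_scale) simp_all
  finally show ?thesis
    using le[of False False] le[of False True] le[of True False] le[of True True]
    by (cases b; cases b') (simp_all add: distrib_right)
next
  case False
  then have "w (b # b' # s) = 0" for b b'
    using run_shape_antimono[of b "b' # s"] run_shape_antimono[of b' s]
    by (simp add: w_def bad_weight_def)
  then show ?thesis by (simp add: w_def bad_weight_nonneg)
qed

lemma total_bad_weight_Suc_Suc:
  assumes "0 \<le> p"
  shows "total_bad_weight p (Suc (Suc n)) \<le> (3 + 0.69 powr p) * total_bad_weight p n"
  unfolding total_bad_weight_def sum_generation_Suc sum_distrib_left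
  by (intro sum_mono weight_grandchildren assms)

lemma total_bad_weight_le:
  assumes p: "0 \<le> p"
  shows "total_bad_weight p n \<le> 2 * (3 + 0.69 powr p) ^ (n div 2) * bad_weight p (shape_measure q T)"
proof (induction n rule: induct_nat_012)
  have R0: "R [] = T" using run by (simp add: refinement_run_def)
  have g0: "generation 0 = {[]}" by (auto simp: generation_def)
  case 0
  show ?case using bad_weight_nonneg[of p] by (simp add: total_bad_weight_def g0 R0)
next
  have R0: "R [] = T" using run by (simp add: refinement_run_def)
  have g0: "generation 0 = {[]}" by (auto simp: generation_def)
  case 1
  have "bad_weight p (shape_measure q (R [b])) \<le> bad_weight p (shape_measure q T)" for b
    using run_shape_antimono[of b "[]"] p by (intro bad_weight_mono) (simp_all add: R0)
  from this[of False] this[of True] show ?case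
    by (simp add: total_bad_weight_def sum_generation_Suc g0)
next
  case (ge2 n)
  have "(3 + 0.69 powr p) * total_bad_weight p n
      \<le> (3 + 0.69 powr p) * (2 * (3 + 0.69 powr p) ^ (n div 2) * bad_weight p (shape_measure q T))"
    by (rule mult_left_mono[OF ge2(1)]) simp
  with total_bad_weight_Suc_Suc[OF p, of n] show ?case by (simp add: mult_ac)
qed

lemma num_bad_le:
  assumes p: "0 \<le> p"
  shows "real (num_bad q R n) \<le> 2 * (3 + 0.69 powr p) ^ (n div 2) * bad_weight p (shape_measure q T)"
proof -
  let ?B = "{s \<in> generation n. 5 \<le> shape_measure q (R s)}"
  have "real (num_bad q R n) = (\<Sum>s\<in>?B. 1)" by (simp add: num_bad_def)
  also have "\<dots> \<le> (\<Sum>s\<in>?B. bad_weight p (shape_measure q (R s)))"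
    using p by (intro sum_mono) (auto simp: bad_weight_def intro!: ge_one_powr_ge_zero)
  also have "\<dots> \<le> total_bad_weight p n"
    unfolding total_bad_weight_def using card_generation(1)
    by (intro sum_mono2) (auto simp: bad_weight_nonneg)
  also note total_bad_weight_le[OF p]
  finally show ?thesis .
qed

text \<open>Choosing \<open>p\<close> such that \<open>0.69 powr p = 1 / n\<close> turns \<open>(\<sigma> / 5) powr p\<close> into exactly
  \<open>n powr k\<close>, while \<open>(3 + 1 / n) ^ (n div 2)\<close> exceeds \<open>3 ^ (n div 2)\<close> by a bounded factor
  only.  The exponential rate is then \<open>sqrt 3\<close>, which is smaller than the cube root of \<open>7\<close> since
  \<open>27 \<le> 49\<close>.\<close>

lemma num_bad_polynomial_times_exponential:
  assumes n: "1 \<le> n"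
  shows "real (num_bad q R n) \<le>
    6 * real n powr ((ln (shape_measure q T) - ln 5) / (- ln 0.69)) * 7 powr (real n / 3)"
proof -
  define p where "p = ln (real n) / (- ln (0.69::real))"
  define k where "k = (ln (shape_measure q T) - ln 5) / (- ln (0.69::real))"
  have l: "ln (0.69::real) < 0" by simp
  have p: "0 \<le> p" unfolding p_def using l n by (intro divide_nonneg_nonneg) auto
  have x: "0.69 powr p = 1 / real n"
    using l n by (simp add: powr_def p_def exp_minus inverse_eq_divide)
  have w: "bad_weight p (shape_measure q T) \<le> real n powr k"
  proof (cases "5 \<le> shape_measure q T")
    case True
    then have "(shape_measure q T / 5) powr p = exp (p * (ln (shape_measure q T) - ln 5))"
      by (simp add: powr_def ln_div)
    also have "\<dots> = real n powr k" using n by (simp add: powr_def k_def p_def)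
    finally show ?thesis using True by (simp add: bad_weight_def)
  qed (simp add: bad_weight_def)
  have "3 + 1 / real n = 3 * (1 + 1 / (3 * real n))" using n by (simp add: field_simps)
  also have "\<dots> \<le> 3 * exp (1 / (3 * real n))"
    by (intro mult_left_mono exp_ge_add_one_self) simp
  finally have "(3 + 1 / real n) ^ (n div 2) \<le> (3 * exp (1 / (3 * real n))) ^ (n div 2)"
    by (intro power_mono) auto
  also have "\<dots> = 3 ^ (n div 2) * exp (real (n div 2) * (1 / (3 * real n)))"
    by (simp only: power_mult_distrib exp_of_nat_mult)
  also have "\<dots> \<le> 3 ^ (n div 2) * 3"
  proof (rule mult_left_mono)
    have "real (n div 2) * (1 / (3 * real n)) \<le> 1" using n by (simp add: field_simps)
    then have "exp (real (n div 2) * (1 / (3 * real n))) \<le> exp 1" by (simp only: exp_le_cancel_iff)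
    then show "exp (real (n div 2) * (1 / (3 * real n))) \<le> 3" using exp_le by linarith
  qed simp
  also have "(3::real) ^ (n div 2) \<le> 7 powr (real n / 3)"
  proof -
    have "(3::real) ^ 3 \<le> (7 powr (2 / 3)) ^ 3"
      by (simp add: powr_power)
    then have "(3::real) \<le> 7 powr (2 / 3)" using power_mono_iff[of "3::real" "7 powr (2 / 3)" 3] by simp
    then have "(3::real) ^ (n div 2) \<le> (7 powr (2 / 3)) ^ (n div 2)" by (intro power_mono) auto
    also have "\<dots> = 7 powr (real (n div 2) * (2 / 3))" by (simp add: powr_power)
    also have "\<dots> \<le> 7 powr (real n / 3)"
    proof (rule powr_mono)
      have "real (2 * (n div 2)) \<le> real n" by (intro of_nat_mono) simp
      then show "real (n div 2) * (2 / 3) \<le> real n / 3" by simp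
    qed simp
    finally show ?thesis .
  qed
  finally have e: "(3 + 1 / real n) ^ (n div 2) \<le> 7 powr (real n / 3) * 3" by simp
  have "real (num_bad q R n) \<le> 2 * (3 + 1 / real n) ^ (n div 2) * bad_weight p (shape_measure q T)"
    using num_bad_le[OF p, of n] by (simp only: x)
  also have "\<dots> \<le> 2 * (7 powr (real n / 3) * 3) * real n powr k"
    using e w by (intro mult_mono) (auto simp: bad_weight_nonneg)
  finally show ?thesis by (simp add: k_def mult_ac)
qed

text \<open>Here \<open>p = 1\<close> suffices: every two generations the weight grows at most by \<open>3.69\<close> whereas the
  number of triangles grows by \<open>4\<close>.  The constant \<open>1.94\<close>, twice \<open>0.97\<close>, satisfies
  \<open>3.69 \<le> 1.94\<^sup>2 < 4\<close>.\<close>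

lemma bad_proportion_exponential_decay:
  "real (num_bad q R n) / 2 ^ n \<le> 2 * bad_weight 1 (shape_measure q T) * 0.97 ^ n"
proof -
  have "(3.69::real) ^ (n div 2) \<le> (1.94\<^sup>2) ^ (n div 2)"
    by (intro power_mono) (auto simp: power2_eq_square)
  also have "\<dots> = 1.94 ^ (2 * (n div 2))" by (simp only: power_mult)
  also have "\<dots> \<le> 1.94 ^ n" by (intro power_increasing) auto
  finally have "(3.69::real) ^ (n div 2) \<le> 1.94 ^ n" .
  moreover have "real (num_bad q R n) \<le> 3.69 ^ (n div 2) * (2 * bad_weight 1 (shape_measure q T))"
    using num_bad_le[of 1 n] by (simp add: mult_ac)
  ultimately have "real (num_bad q R n) \<le> 1.94 ^ n * (2 * bad_weight 1 (shape_measure q T))"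
    using bad_weight_nonneg[of 1 "shape_measure q T"]
    by (meson mult_right_mono order_trans zero_le_mult_iff zero_le_numeral)
  moreover have "(1.94::real) ^ n = 0.97 ^ n * 2 ^ n" by (simp flip: power_mult_distrib)
  ultimately show ?thesis by (simp add: field_simps)
qed

end

theorem theorem3p9:
  "\<exists>C::real. C > 0 \<and>
    (\<forall>(T::triangle) (q::quad_poly) (R::bool list \<Rightarrow> triangle).
      nondegenerate T \<longrightarrow> pos_definite q \<longrightarrow> refinement_run (poly_fun q) T R \<longrightarrow>
        (let k = (ln (shape_measure q T) - ln 5) / (- ln (0.69::real)) in
          \<forall>n::nat. n \<ge> 1 \<longrightarrow>
            real (num_bad q R n) \<le> C * real n powr k * 7 powr (real n / 3)) \<and>
        (\<exists>c \<rho>::real. 0 < \<rho> \<and> \<rho> < 1 \<and>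
          (\<forall>n::nat. real (num_bad q R n) / 2 ^ n \<le> c * \<rho> ^ n)))"
proof (rule exI[of _ "6::real"], intro conjI allI impI)
  fix T :: triangle and q :: quad_poly and R :: "bool list \<Rightarrow> triangle"
  assume hyps: "nondegenerate T" "pos_definite q" "refinement_run (poly_fun q) T R"
  show "let k = (ln (shape_measure q T) - ln 5) / (- ln (0.69::real)) in
      \<forall>n::nat. n \<ge> 1 \<longrightarrow> real (num_bad q R n) \<le> 6 * real n powr k * 7 powr (real n / 3)"
    unfolding Let_def using num_bad_polynomial_times_exponential[OF hyps] by blast
  have "(0::real) < 0.97" "(0.97::real) < 1" by simp_all
  then show "\<exists>c \<rho>::real. 0 < \<rho> \<and> \<rho> < 1 \<and>
      (\<forall>n::nat. real (num_bad q R n) / 2 ^ n \<le> c * \<rho> ^ n)"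
    using bad_proportion_exponential_decay[OF hyps] by blast
qed simp

end
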